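(* Let $(V_1,V_2)$ be a pair of commuting isometries on a Hilbert space $\mathcal H$. Then the following are equivalent: (i) $H(V_1,V_2)-C(V_1,V_2)=0$. (ii) $H(V_1,V_2)-C(V_1,V_2)\geq 0$ or $H(V_1,V_2)-C(V_1,V_2)\leq 0$. (iii) $V_2$ is unitary. (iv) $(V_1V_2,V_2)$ is doubly commuting. (v) $H(V_1,V_2)-C(V_1,V_2)$ is a projection or the negative of a projection. (vi) The operator $J_1$ is an isometry. (vii) The operator $J_2$ is an isometry.
   Context: Hilbert spaces are complex. For a pair $(V_1,V_2)$ of commuting isometries on $\mathcal H$, $H(V_1,V_2):=V_2V_2^*-V_1V_1^*-V_2^2V_2^{*2}+V_1V_2V_1^*V_2^*$ and $C(V_1,V_2):=I-V_1V_1^*-V_2V_2^*+V_1V_2V_1^*V_2^*$. Put $\mathcal W_{1,1}=\mathcal H\ominus V_1V_2\mathcal H=\ker (V_1V_2)^*$ and $\mathcal W_{0,1}=\mathcal H\ominus V_2\mathcal H=\ker V_2^*$. With $P_{\mathcal M}$ the orthogonal projection onto a closed subspace $\mathcal M$, define $J_1:=P_{\mathcal W_{1,1}}V_2|_{\mathcal W_{1,1}}\in B(\mathcal W_{1,1})$ and $J_2:=P_{\mathcal W_{0,1}}V_1V_2|_{\mathcal W_{0,1}}\in B(\mathcal W_{0,1})$ (an operator on the zero space counts as an isometry). A commuting pair $(T_1,T_2)$ is doubly commuting if also $T_1^*T_2=T_2T_1^*$. "Projection" means orthogonal projection. *)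

theory Defs
  imports "HOL-Analysis.Analysis"
begin

class complex_vector = real_vector +
  fixes scaleC :: "complex \<Rightarrow> 'a \<Rightarrow> 'a"  (infixr "*\<^sub>C" 75)
  assumes scaleC_add_right: "a *\<^sub>C (x + y) = a *\<^sub>C x + a *\<^sub>C y"
    and scaleC_add_left: "(a + b) *\<^sub>C x = a *\<^sub>C x + b *\<^sub>C x"
    and scaleC_scaleC: "a *\<^sub>C b *\<^sub>C x = (a * b) *\<^sub>C x"
    and scaleC_one: "1 *\<^sub>C x = x"
    and scaleR_scaleC: "r *\<^sub>R x = complex_of_real r *\<^sub>C x"

text \<open>The complex inner product is linear in its first argument. Its real part is the inner
  product of the library class \<open>real_inner\<close>, so norm and topology are those of
  the underlying real inner product space, and positive definiteness is inherited from there.\<close>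

class complex_inner = complex_vector + real_inner +
  fixes cinner :: "'a \<Rightarrow> 'a \<Rightarrow> complex"
  assumes cinner_commute: "cinner x y = cnj (cinner y x)"
    and cinner_add_left: "cinner (x + y) z = cinner x z + cinner y z"
    and cinner_scaleC_left: "cinner (a *\<^sub>C x) y = a * cinner x y"
    and inner_eq_Re_cinner: "inner x y = Re (cinner x y)"

class complex_hilbert = complex_inner + complete_space

instantiation complex :: complex_hilbert
begin

definition scaleC_complex :: "complex \<Rightarrow> complex \<Rightarrow> complex" where
  "scaleC_complex a x = a * x"

definition cinner_complex :: "complex \<Rightarrow> complex \<Rightarrow> complex" where
  "cinner_complex x y = x * cnj y"

instance
  by standard (auto simp: scaleC_complex_def cinner_complex_def algebra_simps
      scaleR_conv_of_real inner_complex_def)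

end

lemma cinner_self: "cinner x x = complex_of_real ((norm x)\<^sup>2)"
  for x :: "'a::complex_inner"
proof -
  have "Im (cinner x x) = 0"
    using cinner_commute[of x x] by (metis complex_cnj_cancel_iff cnj.simps(2) equal_neg_zero)
  moreover have "Re (cinner x x) = (norm x)\<^sup>2"
    by (simp add: inner_eq_Re_cinner[symmetric] power2_norm_eq_inner)
  ultimately show ?thesis
    by (simp add: complex_eq_iff)
qed

definition bounded_clinear :: "('a::complex_inner \<Rightarrow> 'b::complex_inner) \<Rightarrow> bool" where
  "bounded_clinear T \<longleftrightarrow> bounded_linear T \<and> (\<forall>a x. T (a *\<^sub>C x) = a *\<^sub>C T x)"

definition csubspace :: "'a::complex_vector set \<Rightarrow> bool" where
  "csubspace M \<longleftrightarrow> 0 \<in> M \<and> (\<forall>x\<in>M. \<forall>y\<in>M. x + y \<in> M) \<and> (\<forall>a. \<forall>x\<in>M. a *\<^sub>C x \<in> M)"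

text \<open>A linear isometry of the subspace \<open>M\<close> into itself; only the values on \<open>M\<close> matter.\<close>

definition isometry_on :: "'a::complex_inner set \<Rightarrow> ('a \<Rightarrow> 'a) \<Rightarrow> bool" where
  "isometry_on M T \<longleftrightarrow>
     (\<forall>x\<in>M. T x \<in> M) \<and>
     (\<forall>x\<in>M. \<forall>y\<in>M. T (x + y) = T x + T y) \<and>
     (\<forall>a. \<forall>x\<in>M. T (a *\<^sub>C x) = a *\<^sub>C T x) \<and>
     (\<forall>x\<in>M. norm (T x) = norm x)"

abbreviation isometry :: "('a::complex_inner \<Rightarrow> 'a) \<Rightarrow> bool" where
  "isometry T \<equiv> isometry_on UNIV T"

text \<open>By the Riesz representation theorem and positive definiteness, the description has exactly one
  solution when \<open>T\<close> is bounded linear on a Hilbert space; likewise for \<open>proj\<close> below on closed subspaces.\<close>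

definition cadjoint :: "('a::complex_inner \<Rightarrow> 'a) \<Rightarrow> 'a \<Rightarrow> 'a" where
  "cadjoint T = (THE S. \<forall>x y. cinner (T x) y = cinner x (S y))"

definition unitary :: "('a::complex_inner \<Rightarrow> 'a) \<Rightarrow> bool" where
  "unitary U \<longleftrightarrow> bounded_clinear U \<and> cadjoint U \<circ> U = id \<and> U \<circ> cadjoint U = id"

definition op_nonneg :: "('a::complex_inner \<Rightarrow> 'a) \<Rightarrow> bool" where
  "op_nonneg T \<longleftrightarrow> bounded_clinear T \<and> (\<forall>x. cinner (T x) x \<in> \<real>\<^sub>\<ge>\<^sub>0)"

definition doubly_commuting :: "('a::complex_inner \<Rightarrow> 'a) \<Rightarrow> ('a \<Rightarrow> 'a) \<Rightarrow> bool" where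
  "doubly_commuting T1 T2 \<longleftrightarrow>
     T1 \<circ> T2 = T2 \<circ> T1 \<and> cadjoint T1 \<circ> T2 = T2 \<circ> cadjoint T1"

definition ortho_compl :: "'a::complex_inner set \<Rightarrow> 'a set" where
  "ortho_compl M = {x. \<forall>y\<in>M. cinner x y = 0}"

definition proj :: "'a::complex_inner set \<Rightarrow> 'a \<Rightarrow> 'a" where
  "proj M x = (THE m. m \<in> M \<and> x - m \<in> ortho_compl M)"

definition is_projection :: "('a::complex_inner \<Rightarrow> 'a) \<Rightarrow> bool" where
  "is_projection T \<longleftrightarrow> (\<exists>M. csubspace M \<and> closed M \<and> T = proj M)"

definition compression :: "'a::complex_inner set \<Rightarrow> ('a \<Rightarrow> 'a) \<Rightarrow> 'a \<Rightarrow> 'a" where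
  "compression M T = restrict (\<lambda>x. proj M (T x)) M"

definition H_op :: "('a::complex_inner \<Rightarrow> 'a) \<Rightarrow> ('a \<Rightarrow> 'a) \<Rightarrow> 'a \<Rightarrow> 'a" where
  "H_op V1 V2 x =
     V2 (cadjoint V2 x) - V1 (cadjoint V1 x)
     - V2 (V2 (cadjoint V2 (cadjoint V2 x)))
     + V1 (V2 (cadjoint V1 (cadjoint V2 x)))"

definition C_op :: "('a::complex_inner \<Rightarrow> 'a) \<Rightarrow> ('a \<Rightarrow> 'a) \<Rightarrow> 'a \<Rightarrow> 'a" where
  "C_op V1 V2 x =
     x - V1 (cadjoint V1 x) - V2 (cadjoint V2 x)
     + V1 (V2 (cadjoint V1 (cadjoint V2 x)))"

definition HC_diff :: "('a::complex_inner \<Rightarrow> 'a) \<Rightarrow> ('a \<Rightarrow> 'a) \<Rightarrow> 'a \<Rightarrow> 'a" where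
  "HC_diff V1 V2 x = H_op V1 V2 x - C_op V1 V2 x"

definition W11 :: "('a::complex_inner \<Rightarrow> 'a) \<Rightarrow> ('a \<Rightarrow> 'a) \<Rightarrow> 'a set" where
  "W11 V1 V2 = ortho_compl (range (V1 \<circ> V2))"

definition W01 :: "('a::complex_inner \<Rightarrow> 'a) \<Rightarrow> 'a set" where
  "W01 V2 = ortho_compl (range V2)"

definition J1 :: "('a::complex_inner \<Rightarrow> 'a) \<Rightarrow> ('a \<Rightarrow> 'a) \<Rightarrow> 'a \<Rightarrow> 'a" where
  "J1 V1 V2 = compression (W11 V1 V2) V2"

definition J2 :: "('a::complex_inner \<Rightarrow> 'a) \<Rightarrow> ('a \<Rightarrow> 'a) \<Rightarrow> 'a \<Rightarrow> 'a" where
  "J2 V1 V2 = compression (W01 V2) (V1 \<circ> V2)"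

definition all_equivalent :: "bool list \<Rightarrow> bool" where
  "all_equivalent ps \<longleftrightarrow> (\<forall>p\<in>set ps. \<forall>q\<in>set ps. p \<longleftrightarrow> q)"

end

theory Submission
  imports Defs
begin

text \<open>
  In \<open>H - C\<close> all terms involving \<open>V1\<close> cancel, which leaves
  \<open>2 V2 V2* - V2\<^sup>2 V2*\<^sup>2 - I = P - Q\<close>, where \<open>Q\<close> projects onto \<open>W = ker V2*\<close> and \<open>P\<close>
  onto \<open>V2 W\<close>, a subspace orthogonal to \<open>W\<close>. Testing on \<open>W\<close> and on \<open>V2 W\<close> shows that either sign
  of semidefiniteness forces \<open>W = 0\<close>, that is, \<open>V2\<close> is unitary. Double commutativity of
  \<open>(V1 V2, V2)\<close> reads \<open>V1* = V2 V2* V1*\<close>, and \<open>V1*\<close> is onto. If \<open>J1\<close> is isometric then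
  \<open>V2\<close> maps \<open>W\<^sub>1\<^sub>,\<^sub>1\<close> into itself, so \<open>V1 W \<subseteq> W\<^sub>1\<^sub>,\<^sub>1\<close> is contained in \<open>ker V1*\<close> and
  \<open>W = V1* V1 W = 0\<close>. Finally \<open>J2\<close> is always the zero operator on \<open>W\<close>, because \<open>V1 V2 = V2 V1\<close> has range inside that of \<open>V2\<close>.
\<close>

section \<open>Orthogonal projections\<close>

text \<open>A minimizing sequence is Cauchy, so completeness supplies a limit and closedness keeps
  it in \<open>M\<close>. Distances are squared to suit the parallelogram law.\<close>

lemma closest_point_in_closed_subspace:
  fixes M :: "'a::{real_inner,complete_space} set"
  assumes M: "subspace M" "closed M"
  obtains m where "m \<in> M" "\<And>y. y \<in> M \<Longrightarrow> norm (x - m) \<le> norm (x - y)"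
proof -
  define d where "d = (INF y\<in>M. (norm (x - y))\<^sup>2)"
  have ne: "M \<noteq> {}" using subspace_0[OF M(1)] by auto
  have bdd: "bdd_below ((\<lambda>y. (norm (x - y))\<^sup>2) ` M)" by (rule bdd_belowI[of _ 0]) auto
  have d_le: "d \<le> (norm (x - y))\<^sup>2" if "y \<in> M" for y
    unfolding d_def using bdd that by (rule cINF_lower)
  have "\<exists>y\<in>M. (norm (x - y))\<^sup>2 < d + inverse (real (Suc n))" for n
    using cINF_less_iff[OF ne bdd, of "d + inverse (real (Suc n))"] by (simp add: d_def)
  then obtain y where yM: "\<And>n. y n \<in> M"
    and y: "\<And>n. (norm (x - y n))\<^sup>2 < d + inverse (real (Suc n))"
    by metis
  \<comment> \<open>the parallelogram law, with the midpoint of \<open>y m\<close> and \<open>y n\<close> in \<open>M\<close>\<close>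
  have close: "(norm (y m - y n))\<^sup>2 \<le> 2 * inverse (real (Suc m)) + 2 * inverse (real (Suc n))" for m n
  proof -
    have "(1/2) *\<^sub>R (y m + y n) \<in> M"
      using yM M(1) by (intro subspace_scale subspace_add)
    note d_le[OF this]
    moreover have "(norm (y m - y n))\<^sup>2 + 4 * (norm (x - (1/2) *\<^sub>R (y m + y n)))\<^sup>2
        = 2 * (norm (x - y m))\<^sup>2 + 2 * (norm (x - y n))\<^sup>2"
      by (simp add: power2_norm_eq_inner algebra_simps inner_commute)
    ultimately show ?thesis using y[of m] y[of n] by linarith
  qed
  have "Cauchy y"
  proof (rule metric_CauchyI)
    fix e :: real assume "e > 0"
    then have "e\<^sup>2 / 4 > 0" by simp
    \<comment> \<open>For \<open>m\<close> and \<open>n\<close> from \<open>N\<close> on, the bound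
      in \<open>close\<close> is at most \<open>4 * inverse (real (Suc N))\<close>; hence the
      division by 4.\<close>
    from reals_Archimedean[OF this] obtain N where N: "inverse (real (Suc N)) < e\<^sup>2 / 4" by blast
    have "dist (y m) (y n) < e" if "N \<le> m" "N \<le> n" for m n
    proof -
      have "inverse (real (Suc m)) \<le> inverse (real (Suc N))" "inverse (real (Suc n)) \<le> inverse (real (Suc N))"
        using that by (auto intro!: le_imp_inverse_le)
      with close[of m n] N have "(norm (y m - y n))\<^sup>2 < e\<^sup>2" by linarith
      then show ?thesis using \<open>e > 0\<close> by (simp add: dist_norm power_less_imp_less_base)
    qed
    then show "\<exists>N. \<forall>m\<ge>N. \<forall>n\<ge>N. dist (y m) (y n) < e" by blast
  qed
  then obtain m where m: "y \<longlonglongrightarrow> m" using Cauchy_convergent convergent_def by blast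
  have "(\<lambda>n. (norm (x - y n))\<^sup>2) \<longlonglongrightarrow> (norm (x - m))\<^sup>2"
    by (intro tendsto_intros m)
  moreover have "(\<lambda>n. d + inverse (real (Suc n))) \<longlonglongrightarrow> d + 0"
    by (intro tendsto_intros LIMSEQ_inverse_real_of_nat)
  ultimately have "(norm (x - m))\<^sup>2 \<le> d + 0"
    by (rule LIMSEQ_le) (use y less_imp_le in blast)
  then have "norm (x - m) \<le> norm (x - z)" if "z \<in> M" for z
    using d_le[OF that] by (simp add: power2_le_imp_le)
  moreover have "m \<in> M" using closed_sequentially[OF M(2) yM m] .
  ultimately show thesis by (rule that[rotated])
qed

lemma closest_point_orthogonal:
  fixes z v :: "'a::real_inner"
  assumes "\<And>t. norm z \<le> norm (z - t *\<^sub>R v)"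
  shows "inner z v = 0"
proof (cases "v = 0")
  case False
  \<comment> \<open>This \<open>t\<close> minimizes \<open>norm (z - t *\<^sub>R v)\<close>: it
    subtracts from \<open>z\<close> its projection onto the line through \<open>v\<close>.\<close>
  define t where "t = inner z v / (norm v)\<^sup>2"
  have "(norm z)\<^sup>2 \<le> (norm (z - t *\<^sub>R v))\<^sup>2" using assms by (simp add: power_mono)
  also have "\<dots> = (norm z)\<^sup>2 - (inner z v)\<^sup>2 / (norm v)\<^sup>2"
  proof -
    have "(norm (z - t *\<^sub>R v))\<^sup>2 = (norm z)\<^sup>2 - 2 * t * inner z v + t\<^sup>2 * (norm v)\<^sup>2"
      unfolding power2_norm_eq_inner
      by (simp add: inner_diff_left inner_diff_right inner_commute power2_eq_square)
    with False show ?thesis by (simp add: t_def field_simps power2_eq_square)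
  qed
  finally show ?thesis using False by (simp add: divide_le_0_iff)
qed simp

section \<open>Calculus of the complex inner product\<close>

lemma cinner_add_right: "cinner x (y + z) = cinner x y + cinner x z"
  by (metis cinner_add_left cinner_commute complex_cnj_add)

lemma cinner_scaleC_right: "cinner x (a *\<^sub>C y) = cnj a * cinner x y"
  by (metis cinner_scaleC_left cinner_commute complex_cnj_mult)

lemma cinner_zero_left [simp]: "cinner 0 x = 0"
  using cinner_add_left[of 0 0 x] by simp

lemma cinner_zero_right [simp]: "cinner x 0 = 0"
  using cinner_add_right[of x 0 0] by simp

lemma cinner_minus_left: "cinner (- x) y = - cinner x y"
  using cinner_add_left[of "-x" x y] by (simp add: eq_neg_iff_add_eq_0)

lemma cinner_minus_right: "cinner x (- y) = - cinner x y"
  using cinner_add_right[of x "-y" y] by (simp add: eq_neg_iff_add_eq_0)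

lemma cinner_diff_left: "cinner (x - y) z = cinner x z - cinner y z"
  using cinner_add_left[of x "-y" z] by (simp add: cinner_minus_left)

lemma cinner_diff_right: "cinner x (y - z) = cinner x y - cinner x z"
  using cinner_add_right[of x y "-z"] by (simp add: cinner_minus_right)

lemma cinner_self_eq_0 [simp]: "cinner x x = 0 \<longleftrightarrow> x = 0"
  by (simp add: cinner_self)

lemma Re_cinner_self_nonneg: "0 \<le> Re (cinner x x)"
  by (simp add: cinner_self)

lemma scaleC_zero_right [simp]: "a *\<^sub>C (0::'a::complex_vector) = 0"
  using scaleC_add_right[of a 0 "0::'a"] by simp

text \<open>Adjoints are known only through inner products; this turns such pairings into equations
  between vectors.\<close>

lemma cinner_left_ext:
  assumes "\<And>z. cinner z x = cinner z y"
  shows "x = y"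
proof -
  have "cinner (x - y) (x - y) = 0" using assms by (simp add: cinner_diff_right)
  then show ?thesis by simp
qed

lemma csubspace_imp_subspace: "csubspace M \<Longrightarrow> subspace M"
  unfolding csubspace_def subspace_def by (auto simp: scaleR_scaleC)

lemma orthogonal_decomposition:
  fixes M :: "'a::complex_hilbert set"
  assumes M: "csubspace M" "closed M"
  obtains m where "m \<in> M" "x - m \<in> ortho_compl M"
proof -
  have sub: "subspace M" by (rule csubspace_imp_subspace[OF M(1)])
  obtain m where m: "m \<in> M" "\<And>y. y \<in> M \<Longrightarrow> norm (x - m) \<le> norm (x - y)"
    using closest_point_in_closed_subspace[OF sub M(2)] by blast
  have Re0: "Re (cinner (x - m) v) = 0" if "v \<in> M" for v
    unfolding inner_eq_Re_cinner[symmetric]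
  proof (rule closest_point_orthogonal)
    fix t
    have "m + t *\<^sub>R v \<in> M" using m(1) that sub by (intro subspace_add subspace_scale)
    from m(2)[OF this] show "norm (x - m) \<le> norm (x - m - t *\<^sub>R v)" by (simp add: algebra_simps)
  qed
  \<comment> \<open>Minimality controls only real parts. Multiplying \<open>v\<close> by the
    imaginary unit, which stays in \<open>M\<close>, turns the imaginary part into a real
    part.\<close>
  have "cinner (x - m) v = 0" if "v \<in> M" for v
  proof -
    have "\<i> *\<^sub>C v \<in> M" using M(1) that by (auto simp: csubspace_def)
    from Re0[OF this] Re0[OF that] show ?thesis
      by (simp add: cinner_scaleC_right complex_eq_iff)
  qed
  with m(1) that show thesis by (simp add: ortho_compl_def)
qed

text \<open>Two candidates differ by a vector that lies in both \<open>M\<close> and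
  \<open>ortho_compl M\<close> and is therefore orthogonal to itself.\<close>

lemma proj_eqI:
  assumes M: "subspace M" and m: "m \<in> M" "x - m \<in> ortho_compl M"
  shows "proj M x = m"
  unfolding proj_def
proof (rule the_equality)
  fix n assume n: "n \<in> M \<and> x - n \<in> ortho_compl M"
  have "n - m \<in> M" using n m M by (simp add: subspace_diff)
  with n m have "cinner (x - m) (n - m) = 0" "cinner (x - n) (n - m) = 0"
    by (auto simp: ortho_compl_def)
  then have "cinner (n - m) (n - m) = 0"
    by (simp add: cinner_diff_left)
  then show "n = m" by simp
qed (use m in auto)

lemma proj_mem_and_orthogonal:
  fixes M :: "'a::complex_hilbert set"
  assumes "csubspace M" "closed M"
  shows "proj M x \<in> M" "x - proj M x \<in> ortho_compl M"
proof -
  obtain m where m: "m \<in> M" "x - m \<in> ortho_compl M"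
    using orthogonal_decomposition[OF assms] .
  with proj_eqI[OF csubspace_imp_subspace[OF assms(1)] m]
  show "proj M x \<in> M" "x - proj M x \<in> ortho_compl M" by auto
qed

text \<open>Since \<open>x - T x\<close> is orthogonal to \<open>T x\<close>, the pairing equals the
  squared norm of \<open>T x\<close>.\<close>

lemma is_projection_Re_nonneg:
  fixes T :: "'a::complex_hilbert \<Rightarrow> 'a"
  assumes "is_projection T"
  shows "0 \<le> Re (cinner (T x) x)"
proof -
  obtain M where M: "csubspace M" "closed M" "T = proj M"
    using assms by (auto simp: is_projection_def)
  have "cinner (x - T x) (T x) = 0"
    using proj_mem_and_orthogonal[OF M(1,2), of x] M(3) by (auto simp: ortho_compl_def)
  then have "cinner (T x) (x - T x) = 0"
    by (metis cinner_commute complex_cnj_zero)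
  then have "cinner (T x) x = cinner (T x) (T x)" by (simp add: cinner_diff_right)
  then show ?thesis by (simp add: Re_cinner_self_nonneg)
qed

lemma is_projection_zero: "is_projection (\<lambda>x::'a::complex_hilbert. 0)"
proof -
  have "csubspace {0::'a}"
    by (simp add: csubspace_def)
  moreover have "proj {0} x = 0" for x :: 'a
    by (rule proj_eqI) (auto simp: ortho_compl_def)
  ultimately show ?thesis
    unfolding is_projection_def by (intro exI[of _ "{0}"]) auto
qed

lemma subspace_ortho_compl: "subspace (ortho_compl M)"
  unfolding subspace_def ortho_compl_def
  by (simp add: cinner_add_left cinner_scaleC_left scaleR_scaleC)

section \<open>Adjoints of isometries\<close>

locale hilbert_isometry =
  fixes V :: "'a::complex_hilbert \<Rightarrow> 'a"
  assumes isometry: "isometry V"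
begin

abbreviation adj ("V\<^sup>*") where "V\<^sup>* \<equiv> cadjoint V"

lemma add: "V (x + y) = V x + V y"
  and scaleC: "V (a *\<^sub>C x) = a *\<^sub>C V x"
  and norm [simp]: "norm (V x) = norm x"
  using isometry by (auto simp: isometry_on_def)

lemma bounded_linear: "bounded_linear V"
  by (rule bounded_linear_intro[where K = 1]) (simp_all add: add scaleC scaleR_scaleC)

lemma bounded_clinear: "bounded_clinear V"
  by (simp add: bounded_clinear_def bounded_linear scaleC)

lemma zero [simp]: "V 0 = 0"
  using bounded_linear by (rule linear_simps)

lemma diff: "V (x - y) = V x - V y"
  using bounded_linear by (rule linear_simps)

text \<open>Polarization: expanding the norm of \<open>x + y\<close> gives the real part, and
  multiplying \<open>y\<close> by the imaginary unit gives the imaginary part.\<close>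

lemma cinner_map [simp]: "cinner (V x) (V y) = cinner x y"
proof -
  have Re: "Re (cinner (V x) (V y)) = Re (cinner x y)" for x y
  proof -
    have "(norm (V (x + y)))\<^sup>2 = (norm (x + y))\<^sup>2" by simp
    moreover have "inner (V z) (V z) = inner z z" for z
      by (simp flip: power2_norm_eq_inner)
    ultimately have "inner (V x) (V y) = inner x y"
      by (simp add: add power2_norm_eq_inner inner_add_left inner_add_right inner_commute)
    then show ?thesis by (simp add: inner_eq_Re_cinner)
  qed
  from Re[of x y] Re[of x "\<i> *\<^sub>C y"] show ?thesis
    by (simp add: scaleC cinner_scaleC_right complex_eq_iff)
qed

lemma csubspace_range: "csubspace (range V)"
  unfolding csubspace_def by (auto simp: add[symmetric] scaleC[symmetric] intro: range_eqI[of _ _ 0])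

lemma closed_range: "closed (range V)"
proof -
  have "complete (range V)"
    by (rule complete_isometric_image[where e = 1])
      (auto simp: subspace_UNIV bounded_linear complete_UNIV)
  then show ?thesis by (rule complete_imp_closed)
qed

text \<open>Instead of Riesz representation: project \<open>y\<close> onto the closed range of
  \<open>V\<close> and take the preimage of that projection as \<open>z\<close>.\<close>

lemma ex_adjoint: "\<exists>z. \<forall>x. cinner (V x) y = cinner x z"
proof -
  obtain m where m: "m \<in> range V" "y - m \<in> ortho_compl (range V)"
    using orthogonal_decomposition[OF csubspace_range closed_range] .
  then obtain z where z: "m = V z" by auto
  have "cinner (V x) y = cinner x z" for x
  proof -
    have "cinner (y - m) (V x) = 0" using m by (auto simp: ortho_compl_def)
    then have "cinner (V x) (y - m) = 0" by (metis cinner_commute complex_cnj_zero)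
    then show ?thesis by (simp add: z cinner_diff_right)
  qed
  then show ?thesis by blast
qed

lemma cinner_adj: "cinner (V x) y = cinner x (V\<^sup>* y)"
proof -
  from ex_adjoint obtain S where S: "\<And>x y. cinner (V x) y = cinner x (S y)" by metis
  have "cadjoint V = S"
    unfolding cadjoint_def
  proof (rule the_equality)
    fix T assume T: "\<forall>x y. cinner (V x) y = cinner x (T y)"
    show "T = S"
    proof
      fix y show "T y = S y"
        by (rule cinner_left_ext) (metis S T)
    qed
  qed (use S in blast)
  then show ?thesis using S by simp
qed

lemma cinner_adj': "cinner x (V y) = cinner (V\<^sup>* x) y"
  by (metis cinner_adj cinner_commute)

lemma adj_map [simp]: "V\<^sup>* (V x) = x"
  by (rule cinner_left_ext) (simp add: cinner_adj[symmetric])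

lemma adj_diff: "V\<^sup>* (x - y) = V\<^sup>* x - V\<^sup>* y"
  by (rule cinner_left_ext) (simp add: cinner_adj[symmetric] cinner_diff_right)

lemma adj_zero [simp]: "V\<^sup>* 0 = 0"
  using adj_diff[of 0 0] by simp

section \<open>Kernel of the adjoint, range projection and unitarity\<close>

lemma ortho_compl_range: "ortho_compl (range V) = {x. V\<^sup>* x = 0}"
proof -
  have "(\<forall>y. cinner (V\<^sup>* x) y = 0) \<longleftrightarrow> V\<^sup>* x = 0" for x
    using cinner_self_eq_0 by (metis cinner_zero_left)
  then show ?thesis by (auto simp: ortho_compl_def cinner_adj')
qed

lemma proj_ortho_compl_range: "proj (ortho_compl (range V)) x = x - V (V\<^sup>* x)"
proof (rule proj_eqI[OF subspace_ortho_compl])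
  show "x - V (V\<^sup>* x) \<in> ortho_compl (range V)"
    by (simp add: ortho_compl_range adj_diff)
  \<comment> \<open>The difference is \<open>V (V\<^sup>* x)\<close>, and a vector of the range is
    orthogonal to the kernel of the adjoint.\<close>
  show "x - (x - V (V\<^sup>* x)) \<in> ortho_compl (ortho_compl (range V))"
    unfolding ortho_compl_range by (simp add: ortho_compl_def cinner_adj)
qed

text \<open>Pythagoras: the squared norm of \<open>x - V (V\<^sup>* x)\<close> is that of
  \<open>x\<close> minus that of \<open>V\<^sup>* x\<close>.\<close>

lemma norm_proj_eqD:
  assumes "norm (x - V (V\<^sup>* x)) = norm x"
  shows "V\<^sup>* x = 0"
proof -
  have "cinner (x - V (V\<^sup>* x)) (x - V (V\<^sup>* x)) = cinner x x"
    using assms by (simp add: cinner_self)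
  then show ?thesis
    by (simp add: cinner_diff_left cinner_diff_right cinner_adj' cinner_adj adj_diff)
qed

lemma unitary_iff: "unitary V \<longleftrightarrow> (\<forall>x. V (V\<^sup>* x) = x)"
  by (auto simp: unitary_def bounded_clinear fun_eq_iff)

text \<open>The defect \<open>V (V\<^sup>* x) - x\<close> always lies in the kernel of the adjoint.
  Unitarity thus becomes triviality of that kernel, the form used for most of the
  equivalences.\<close>

lemma unitary_iff_adj_inj: "unitary V \<longleftrightarrow> (\<forall>x. V\<^sup>* x = 0 \<longrightarrow> x = 0)"
proof
  show "\<forall>x. V\<^sup>* x = 0 \<longrightarrow> x = 0" if "unitary V"
    using that by (metis unitary_iff zero)
  show "unitary V" if inj: "\<forall>x. V\<^sup>* x = 0 \<longrightarrow> x = 0"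
    unfolding unitary_iff
  proof
    fix x
    have "V\<^sup>* (V (V\<^sup>* x) - x) = 0" by (simp add: adj_diff)
    with inj show "V (V\<^sup>* x) = x" by (metis eq_iff_diff_eq_0)
  qed
qed

end

section \<open>Commuting pairs of isometries\<close>

locale commuting_isometries =
  V1: hilbert_isometry V1 + V2: hilbert_isometry V2
  for V1 V2 :: "'a::complex_hilbert \<Rightarrow> 'a" +
  assumes commute: "V1 \<circ> V2 = V2 \<circ> V1"
begin

lemma commute': "V1 (V2 x) = V2 (V1 x)"
  using commute by (metis comp_apply)

text \<open>The product is itself an isometry, so its adjoint and the projection onto
  \<open>W11 V1 V2\<close> are covered by the results for one isometry.\<close>

sublocale V12: hilbert_isometry "V1 \<circ> V2"
  by standard (simp add: isometry_on_def V1.add V2.add V1.scaleC V2.scaleC)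

lemma adj_comp: "cadjoint (V1 \<circ> V2) x = cadjoint V2 (cadjoint V1 x)"
  by (rule cinner_left_ext) (simp add: V12.cinner_adj[symmetric] V1.cinner_adj[symmetric] V2.cinner_adj[symmetric])

lemma adj_comp': "cadjoint (V1 \<circ> V2) x = cadjoint V1 (cadjoint V2 x)"
  by (rule cinner_left_ext)
    (simp add: V12.cinner_adj[symmetric] V1.cinner_adj[symmetric] V2.cinner_adj[symmetric] commute')

lemma adj_commute: "cadjoint V2 (cadjoint V1 x) = cadjoint V1 (cadjoint V2 x)"
  by (simp flip: adj_comp adj_comp')

section \<open>Sign conditions on \<open>HC_diff\<close> and double commutativity\<close>

lemma HC_diff_eq:
  "HC_diff V1 V2 x = 2 *\<^sub>R V2 (cadjoint V2 x) - V2 (V2 (cadjoint V2 (cadjoint V2 x))) - x"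
  by (simp add: HC_diff_def H_op_def C_op_def scaleR_2)

lemma HC_diff_zero_iff_unitary: "HC_diff V1 V2 = (\<lambda>x. 0) \<longleftrightarrow> unitary V2"
proof
  assume "HC_diff V1 V2 = (\<lambda>x. 0)"
  \<comment> \<open>On the kernel of \<open>cadjoint V2\<close> the operator acts as minus the
    identity.\<close>
  then have "x = 0" if "cadjoint V2 x = 0" for x
    using HC_diff_eq[of x] that by simp
  then show "unitary V2" by (simp add: V2.unitary_iff_adj_inj)
next
  assume "unitary V2"
  then show "HC_diff V1 V2 = (\<lambda>x. 0)"
    by (simp add: fun_eq_iff HC_diff_eq V2.unitary_iff scaleR_2)
qed

text \<open>Only the sign of the quadratic form enters, so semidefiniteness and the projection
  condition can share this argument.\<close>

lemma unitary_if_HC_diff_semidefinite: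
  assumes "(\<forall>x. 0 \<le> Re (cinner (HC_diff V1 V2 x) x)) \<or> (\<forall>x. Re (cinner (HC_diff V1 V2 x) x) \<le> 0)"
  shows "unitary V2"
  unfolding V2.unitary_iff_adj_inj
proof (intro allI impI)
  fix w assume w: "cadjoint V2 w = 0"
  have "HC_diff V1 V2 w = - w" "HC_diff V1 V2 (V2 w) = V2 w"
    using w by (simp_all add: HC_diff_eq scaleR_2)
  then have "Re (cinner (HC_diff V1 V2 w) w) = - (norm w)\<^sup>2"
    "Re (cinner (HC_diff V1 V2 (V2 w)) (V2 w)) = (norm w)\<^sup>2"
    by (simp_all add: cinner_minus_left cinner_self)
  \<comment> \<open>A nonnegative form is contradicted at \<open>w\<close>, a nonpositive one at
    \<open>V2 w\<close>, unless \<open>w\<close> vanishes.\<close>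
  with assms have "(norm w)\<^sup>2 \<le> 0" by (metis neg_0_le_iff_le)
  then show "w = 0" by simp
qed

lemma HC_diff_op_nonneg_iff_unitary:
  "op_nonneg (HC_diff V1 V2) \<or> op_nonneg (\<lambda>x. - HC_diff V1 V2 x) \<longleftrightarrow> unitary V2"
proof
  assume "op_nonneg (HC_diff V1 V2) \<or> op_nonneg (\<lambda>x. - HC_diff V1 V2 x)"
  then show "unitary V2"
    by (intro unitary_if_HC_diff_semidefinite)
      (auto simp: op_nonneg_def complex_nonneg_Reals_iff cinner_minus_left)
next
  assume "unitary V2"
  then have "HC_diff V1 V2 = (\<lambda>x. 0)" by (simp add: HC_diff_zero_iff_unitary)
  then show "op_nonneg (HC_diff V1 V2) \<or> op_nonneg (\<lambda>x. - HC_diff V1 V2 x)"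
    by (simp add: op_nonneg_def bounded_clinear_def)
qed

lemma HC_diff_projection_iff_unitary:
  "is_projection (HC_diff V1 V2) \<or> is_projection (\<lambda>x. - HC_diff V1 V2 x) \<longleftrightarrow> unitary V2"
proof
  assume "is_projection (HC_diff V1 V2) \<or> is_projection (\<lambda>x. - HC_diff V1 V2 x)"
  then show "unitary V2"
    by (intro unitary_if_HC_diff_semidefinite)
      (auto dest: is_projection_Re_nonneg simp: cinner_minus_left)
next
  assume "unitary V2"
  then have "HC_diff V1 V2 = (\<lambda>x. 0)" by (simp add: HC_diff_zero_iff_unitary)
  then show "is_projection (HC_diff V1 V2) \<or> is_projection (\<lambda>x. - HC_diff V1 V2 x)"
    by (simp add: is_projection_zero)
qed

lemma doubly_commuting_iff_unitary: "doubly_commuting (V1 \<circ> V2) V2 \<longleftrightarrow> unitary V2"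
proof -
  have "doubly_commuting (V1 \<circ> V2) V2 \<longleftrightarrow> (\<forall>x. cadjoint V1 x = V2 (cadjoint V2 (cadjoint V1 x)))"
    by (simp add: doubly_commuting_def fun_eq_iff commute' adj_comp' adj_commute)
  \<comment> \<open>Every vector has the form \<open>cadjoint V1 (V1 x)\<close>, so the identity on
    the range of \<open>cadjoint V1\<close> holds everywhere.\<close>
  also have "\<dots> \<longleftrightarrow> unitary V2"
    unfolding V2.unitary_iff by (metis V1.adj_map)
  finally show ?thesis .
qed

section \<open>The compressions \<open>J1\<close> and \<open>J2\<close>\<close>

lemma J1_eq:
  "x \<in> W11 V1 V2 \<Longrightarrow> J1 V1 V2 x = V2 x - (V1 \<circ> V2) (cadjoint (V1 \<circ> V2) (V2 x))"
  by (simp only: J1_def compression_def W11_def restrict_apply' V12.proj_ortho_compl_range)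

lemma W11_eq: "W11 V1 V2 = {x. cadjoint V2 (cadjoint V1 x) = 0}"
  by (simp only: W11_def V12.ortho_compl_range adj_comp)

lemma J1_isometry_iff_unitary: "isometry_on (W11 V1 V2) (J1 V1 V2) \<longleftrightarrow> unitary V2"
proof
  assume iso: "isometry_on (W11 V1 V2) (J1 V1 V2)"
  show "unitary V2"
    unfolding V2.unitary_iff_adj_inj
  proof (intro allI impI)
    fix w assume "cadjoint V2 w = 0"
    then have mem: "V1 w \<in> W11 V1 V2" by (simp add: W11_eq)
    with iso have "norm (J1 V1 V2 (V1 w)) = norm (V2 (V1 w))"
      by (simp add: isometry_on_def)
    \<comment> \<open>Projecting \<open>V2 (V1 w)\<close> onto \<open>W11 V1 V2\<close> loses no
      norm, so its component in the range of the product is zero.\<close>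
    then have "cadjoint (V1 \<circ> V2) (V2 (V1 w)) = 0"
      unfolding J1_eq[OF mem] by (rule V12.norm_proj_eqD)
    \<comment> \<open>By commutativity \<open>V2 (V1 w)\<close> is the image of \<open>w\<close>
      under the product, whose adjoint returns \<open>w\<close>.\<close>
    then show "w = 0" by (simp add: adj_comp')
  qed
next
  assume U: "unitary V2"
  have W: "W11 V1 V2 = {x. cadjoint V1 x = 0}"
    using U by (auto simp: W11_eq V2.unitary_iff_adj_inj)
  \<comment> \<open>Here \<open>V2\<close> leaves the kernel of \<open>cadjoint V1\<close>
    invariant, so the compression is \<open>V2\<close> itself.\<close>
  have J: "J1 V1 V2 x = V2 x" and mem: "V2 x \<in> W11 V1 V2" if "x \<in> W11 V1 V2" for x
  proof -
    have 0: "cadjoint (V1 \<circ> V2) (V2 x) = 0" using that by (simp add: W adj_comp')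
    then show "J1 V1 V2 x = V2 x" by (simp add: J1_eq[OF that])
    show "V2 x \<in> W11 V1 V2" using 0 by (simp add: W11_eq adj_comp)
  qed
  \<comment> \<open>Outside \<open>W11 V1 V2\<close> the restricted function \<open>J1\<close> is
    \<open>undefined\<close>, so linearity requires sums and multiples to stay inside.\<close>
  have sub: "subspace (W11 V1 V2)" by (simp add: W11_def subspace_ortho_compl)
  have scale: "a *\<^sub>C x \<in> W11 V1 V2" if "x \<in> W11 V1 V2" for a x
    using that by (simp add: W11_def ortho_compl_def cinner_scaleC_left)
  show "isometry_on (W11 V1 V2) (J1 V1 V2)"
    unfolding isometry_on_def
    using sub by (simp add: J mem scale subspace_add V2.add V2.scaleC)
qed

lemma J2_isometry_iff_unitary: "isometry_on (W01 V2) (J2 V1 V2) \<longleftrightarrow> unitary V2"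
proof -
  \<comment> \<open>By commutativity \<open>V1 (V2 x)\<close> lies in the range of
    \<open>V2\<close>, which the projection onto \<open>W01 V2\<close> kills.\<close>
  have J2: "J2 V1 V2 x = 0" if "x \<in> W01 V2" for x
    using that by (simp add: J2_def W01_def compression_def V2.proj_ortho_compl_range commute')
  have W: "W01 V2 = {x. cadjoint V2 x = 0}"
    by (simp add: W01_def V2.ortho_compl_range)
  show ?thesis
  proof
    assume "isometry_on (W01 V2) (J2 V1 V2)"
    then show "unitary V2"
      unfolding V2.unitary_iff_adj_inj using J2 W by (auto simp: isometry_on_def)
  next
    assume "unitary V2"
    then have "W01 V2 = {0}" using W by (auto simp: V2.unitary_iff_adj_inj)
    then show "isometry_on (W01 V2) (J2 V1 V2)"
      using J2 by (simp add: isometry_on_def)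
  qed
qed

end

theorem theorem2p12:
  fixes V1 V2 :: "'a::complex_hilbert \<Rightarrow> 'a"
  assumes "isometry V1" and "isometry V2" and "V1 \<circ> V2 = V2 \<circ> V1"
  shows "all_equivalent
    [HC_diff V1 V2 = (\<lambda>x. 0),
     op_nonneg (HC_diff V1 V2) \<or> op_nonneg (\<lambda>x. - HC_diff V1 V2 x),
     unitary V2,
     doubly_commuting (V1 \<circ> V2) V2,
     is_projection (HC_diff V1 V2) \<or> is_projection (\<lambda>x. - HC_diff V1 V2 x),
     isometry_on (W11 V1 V2) (J1 V1 V2),
     isometry_on (W01 V2) (J2 V1 V2)]"
proof -
  interpret commuting_isometries V1 V2
    using assms by unfold_locales
  show ?thesis
    \<comment> \<open>Every entry becomes \<open>unitary V2\<close>, so the list is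
      constant.\<close>
    unfolding HC_diff_zero_iff_unitary HC_diff_op_nonneg_iff_unitary doubly_commuting_iff_unitary
      HC_diff_projection_iff_unitary J1_isometry_iff_unitary J2_isometry_iff_unitary
    by (simp add: all_equivalent_def)
qed

end
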